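(* Let $R = K[x_1, \ldots, x_n]$ be a polynomial ring in $n$ variables over a field $K$. Let $I$ be a monomial ideal such that $\operatorname{ht}(I) \geq 2$ and all minimal monomial generators of $I$ have the same degree. Then the special fiber ring of $I$ and the special fiber ring of its LCM-dual $\widehat{I}$ are isomorphic: $$\mathcal F(I) = K[It] \cong K[\widehat{I} t ]= \mathcal F(\widehat I).$$
   Context: For a monomial ideal $I \subseteq R = K[x_1,\ldots,x_n]$ with (unique) minimal set of monomial generators $\{f_1,\ldots,f_\nu\}$, put $m_I = \operatorname{lcm}(f_1,\ldots,f_\nu)$. The LCM-dual of $I$ is the monomial ideal $\widehat I$ generated by the monomials $\widehat{f_i} = m_I/f_i$, $i=1,\ldots,\nu$. The special fiber ring of a monomial ideal $I$ minimally generated by monomials $f_1,\ldots,f_\nu$ is the $K$-subalgebra $\mathcal F(I) = K[It] := K[f_1t,\ldots,f_\nu t]$ of $R[t]$, where $t$ is a new variable. Isomorphisms are of $K$-algebras. *)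

theory Defs
  imports
    "HOL-Library.Poly_Mapping"
    "HOL-Library.Extended_Nat"
    "HOL-Computational_Algebra.Polynomial"
    "HOL-Algebra.QuotRing"
    "HOL-Algebra.Generated_Rings"
    "HOL-Algebra.Algebraic_Closure_Type"
begin

text \<open>
  A monomial is an exponent vector of type \<open>'v \<Rightarrow>\<^sub>0 nat\<close>, so multiplication of monomials is
  addition of exponents. For a finite type \<open>'v\<close> with \<open>n\<close> elements, \<open>('v, 'k) mpoly\<close> with
  its type class operations is \<open>K[x\<^sub>1,\<dots>,x\<^sub>n]\<close>.
\<close>

type_synonym ('v, 'k) mpoly = "('v \<Rightarrow>\<^sub>0 nat) \<Rightarrow>\<^sub>0 'k"

definition mpoly_monom :: "('v \<Rightarrow>\<^sub>0 nat) \<Rightarrow> ('v, 'k::field) mpoly" where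
  "mpoly_monom e = Poly_Mapping.single e 1"

definition monom_degree :: "('v::finite \<Rightarrow>\<^sub>0 nat) \<Rightarrow> nat" where
  "monom_degree e = (\<Sum>i\<in>UNIV. Poly_Mapping.lookup e i)"

text \<open>Chains \<open>C 0 \<subset> \<dots> \<subset> C n = P\<close> of primes are counted by their number \<open>n\<close> of strict inclusions.\<close>

definition prime_height :: "('a, 'b) ring_scheme \<Rightarrow> 'a set \<Rightarrow> enat" where
  "prime_height R P =
     (SUP n \<in> {n. \<exists>C :: nat \<Rightarrow> 'a set. C n = P \<and> (\<forall>i\<le>n. primeideal (C i) R) \<and>
                   (\<forall>i<n. C i \<subset> C (Suc i))}. enat n)"

text \<open>The unit ideal has height \<open>\<infinity>\<close>, the infimum of the empty set.\<close>

definition ideal_height :: "('a, 'b) ring_scheme \<Rightarrow> 'a set \<Rightarrow> enat" where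
  "ideal_height R I = (INF P \<in> {P. primeideal P R \<and> I \<subseteq> P}. prime_height R P)"

definition monomial_ideal_of :: "('v \<Rightarrow>\<^sub>0 nat) set \<Rightarrow> ('v, 'k::field) mpoly set" where
  "monomial_ideal_of S = Idl\<^bsub>ring_of_type_algebra\<^esub> (mpoly_monom ` S)"

definition monomial_ideal :: "('v, 'k::field) mpoly set \<Rightarrow> bool" where
  "monomial_ideal I \<longleftrightarrow> (\<exists>S. I = monomial_ideal_of S)"

text \<open>
  Every monomial ideal has exactly one inclusion-minimal set of monomial generators, namely
  the set of those monomials of \<open>I\<close> that are minimal with respect to divisibility.
\<close>

definition min_gens :: "('v, 'k::field) mpoly set \<Rightarrow> ('v \<Rightarrow>\<^sub>0 nat) set" where
  "min_gens I = (THE S. monomial_ideal_of S = I \<and> (\<forall>T. T \<subset> S \<longrightarrow> monomial_ideal_of T \<noteq> I))"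

text \<open>The exponent of each variable in the lcm is the maximum; \<open>Sup {} = 0\<close> gives \<open>lcm {} = 1\<close>.\<close>

definition monom_lcm :: "('v::finite \<Rightarrow>\<^sub>0 nat) set \<Rightarrow> ('v \<Rightarrow>\<^sub>0 nat)" where
  "monom_lcm S = Abs_poly_mapping (\<lambda>i. Sup ((\<lambda>e. Poly_Mapping.lookup e i) ` S))"

definition lcm_dual :: "('v::finite, 'k::field) mpoly set \<Rightarrow> ('v, 'k) mpoly set" where
  "lcm_dual I = monomial_ideal_of ((\<lambda>f. monom_lcm (min_gens I) - f) ` min_gens I)"

text \<open>The embedding of \<open>K\<close> into \<open>R[t]\<close>; here \<open>t\<close> is the variable of the univariate type \<open>poly\<close>.\<close>

definition const_Rt :: "'k::field \<Rightarrow> ('v, 'k) mpoly poly" where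
  "const_Rt c = [: Poly_Mapping.single 0 c :]"

definition special_fiber :: "('v, 'k::field) mpoly set \<Rightarrow> ('v, 'k) mpoly poly set" where
  "special_fiber I =
     generate_ring ring_of_type_algebra
       (range const_Rt \<union> (\<lambda>f. Polynomial.monom (mpoly_monom f) 1) ` min_gens I)"

definition K_alg_isomorphic ::
    "('v, 'k::field) mpoly poly set \<Rightarrow> ('v, 'k) mpoly poly set \<Rightarrow> bool" where
  "K_alg_isomorphic A B \<longleftrightarrow>
     (\<exists>h \<in> ring_iso (ring_of_type_algebra\<lparr>carrier := A\<rparr>) (ring_of_type_algebra\<lparr>carrier := B\<rparr>).
        \<forall>c. h (const_Rt c) = const_Rt c)"

end

theory Submission
  imports Defs
begin

text \<open>
  Let \<open>m\<close> be the lcm of the minimal generators of \<open>I\<close>. The special fiber ring of \<open>I\<close> is spanned by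
  the monomials \<open>x\<^sup>e t\<^sup>j\<close> in which \<open>x\<^sup>e\<close> is a product of \<open>j\<close> generators, and such an \<open>x\<^sup>e\<close> divides
  \<open>m\<^sup>j\<close>. On the \<open>K\<close>-span \<open>D\<close> of all \<open>x\<^sup>e t\<^sup>j\<close> with \<open>x\<^sup>e\<close> dividing \<open>m\<^sup>j\<close> there is the reflection
  \<open>x\<^sup>e t\<^sup>j \<mapsto> (m\<^sup>j / x\<^sup>e) t\<^sup>j\<close>. It is \<open>K\<close>-linear, it is multiplicative because
  \<open>(m\<^sup>j / x\<^sup>e) (m\<^sup>l / x\<^sup>f) = m\<^sup>j\<^sup>+\<^sup>l / x\<^sup>e\<^sup>+\<^sup>f\<close>, and it is its own inverse, so it is an automorphism of the
  \<open>K\<close>-algebra \<open>D\<close>. It exchanges \<open>f t\<close> and \<open>(m/f) t\<close>, hence it exchanges the subalgebra generated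
  by all \<open>f t\<close> and the one generated by all \<open>(m/f) t\<close>
  (\<open>reflect_generated_algebra\<close>, \<open>K_alg_isomorphic_complement\<close>).

  What remains is that the second subalgebra is the special fiber ring of the LCM-dual, that is,
  that the monomials \<open>m/f\<close> are the minimal generators of the ideal they generate. Taking
  complements in \<open>m\<close> reverses divisibility, so they form an antichain because the \<open>f\<close> do, and an
  antichain of monomials is the minimal generating set of its ideal
  (\<open>min_gens_monomial_ideal_of\<close>).
\<close>

section \<open>Divisibility of monomials\<close>

abbreviation divides :: "('v \<Rightarrow>\<^sub>0 nat) \<Rightarrow> ('v \<Rightarrow>\<^sub>0 nat) \<Rightarrow> bool" (infix "\<preceq>" 50) where
  "e \<preceq> f \<equiv> \<forall>i. Poly_Mapping.lookup e i \<le> Poly_Mapping.lookup f i"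

definition antichain :: "('v \<Rightarrow>\<^sub>0 nat) set \<Rightarrow> bool" where
  "antichain S \<longleftrightarrow> (\<forall>e\<in>S. \<forall>f\<in>S. e \<preceq> f \<longrightarrow> e = f)"

definition multiples :: "('v \<Rightarrow>\<^sub>0 nat) set \<Rightarrow> ('v \<Rightarrow>\<^sub>0 nat) set" where
  "multiples S = {e. \<exists>s\<in>S. s \<preceq> e}"

lemma divides_antisym: "e \<preceq> f \<Longrightarrow> f \<preceq> e \<Longrightarrow> e = f"
  by (intro poly_mapping_eqI) (simp add: le_antisym)

lemma divides_add_diff: "e \<preceq> f \<Longrightarrow> e + (f - e) = f"
  by (intro poly_mapping_eqI) (simp add: lookup_add lookup_minus)

lemma complement_divides: "m - f \<preceq> m"
  by (simp add: lookup_minus)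

lemma complement_complement: "f \<preceq> m \<Longrightarrow> m - (m - f) = f"
  by (intro poly_mapping_eqI) (simp add: lookup_minus)

lemma complement_divides_iff:
  assumes "e \<preceq> m" "f \<preceq> m"
  shows "m - e \<preceq> m - f \<longleftrightarrow> f \<preceq> e"
proof -
  have "a \<le> c \<Longrightarrow> b \<le> c \<Longrightarrow> c - a \<le> c - b \<longleftrightarrow> b \<le> a" for a b c :: nat
    by arith
  then show ?thesis
    using assms by (simp add: lookup_minus)
qed

lemma antichain_complement:
  assumes "antichain S" "\<forall>f\<in>S. f \<preceq> m"
  shows "antichain ((\<lambda>f. m - f) ` S)"
  unfolding antichain_def
proof (intro ballI impI)
  fix a b
  assume "a \<in> (\<lambda>f. m - f) ` S" "b \<in> (\<lambda>f. m - f) ` S" and ab: "a \<preceq> b"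
  then obtain e f where e: "e \<in> S" "a = m - e" and f: "f \<in> S" "b = m - f"
    by auto
  then have "f \<preceq> e"
    using ab complement_divides_iff[of e m f] assms(2) by simp
  then have "f = e"
    using assms(1) e(1) f(1) by (simp add: antichain_def)
  with e f show "a = b"
    by simp
qed

lemma monom_degree_less:
  fixes e f :: "'v::finite \<Rightarrow>\<^sub>0 nat"
  assumes "e \<preceq> f" "e \<noteq> f"
  shows "monom_degree e < monom_degree f"
proof -
  obtain i where "\<not> Poly_Mapping.lookup f i \<le> Poly_Mapping.lookup e i"
    using assms divides_antisym by blast
  then show ?thesis
    unfolding monom_degree_def using assms(1)
    by (intro sum_strict_mono_ex1) (auto intro!: exI[of _ i] simp: not_le)
qed

text \<open>Divisibility is well-founded since proper divisors have smaller degree.\<close>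

lemma ex_minimal_divisor:
  fixes e :: "'v::finite \<Rightarrow>\<^sub>0 nat"
  assumes "e \<in> S"
  shows "\<exists>f\<in>S. f \<preceq> e \<and> (\<forall>g\<in>S. g \<preceq> f \<longrightarrow> g = f)"
  using assms
proof (induction "monom_degree e" arbitrary: e rule: less_induct)
  case less
  show ?case
  proof (cases "\<forall>g\<in>S. g \<preceq> e \<longrightarrow> g = e")
    case True
    then show ?thesis using less.prems by auto
  next
    case False
    then obtain g where g: "g \<in> S" "g \<preceq> e" "g \<noteq> e" by blast
    with less.hyps monom_degree_less obtain f
      where "f \<in> S" "f \<preceq> g" "\<forall>h\<in>S. h \<preceq> f \<longrightarrow> h = f" by metis
    with g(2) show ?thesis by (meson order_trans)
  qed
qed

lemma ex_antichain_multiples_eq: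
  fixes S :: "('v::finite \<Rightarrow>\<^sub>0 nat) set"
  shows "\<exists>T. antichain T \<and> multiples T = multiples S"
proof (intro exI conjI)
  let ?T = "{f \<in> S. \<forall>g\<in>S. g \<preceq> f \<longrightarrow> g = f}"
  show "antichain ?T"
    by (auto simp: antichain_def)
  show "multiples ?T = multiples S"
    unfolding multiples_def using ex_minimal_divisor[of _ S]
    by (auto; meson order_trans)
qed

text \<open>The members of an antichain are the minimal elements of the set of its multiples, so every
  other description of that set contains them.\<close>

lemma antichain_subset:
  assumes "antichain S" "multiples T = multiples S"
  shows "S \<subseteq> T"
proof
  fix s assume s: "s \<in> S"
  then have "s \<in> multiples T"
    unfolding assms(2) by (auto simp: multiples_def)
  then obtain t where t: "t \<in> T" "t \<preceq> s"
    by (auto simp: multiples_def)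
  then have "t \<in> multiples S"
    unfolding assms(2)[symmetric] by (auto simp: multiples_def)
  then obtain s' where s': "s' \<in> S" "s' \<preceq> t"
    by (auto simp: multiples_def)
  with t(2) have "s' \<preceq> s"
    by (meson order_trans)
  with s s'(1) assms(1) have "s' = s"
    by (simp add: antichain_def)
  with s' t show "s \<in> T"
    using divides_antisym by metis
qed

lemma lookup_monom_lcm:
  "Poly_Mapping.lookup (monom_lcm S) i = Sup ((\<lambda>e. Poly_Mapping.lookup e i) ` S)"
  by (simp add: monom_lcm_def)

text \<open>Monomials of equal degree have bounded exponents, so the suprema of exponents in the lcm are
  suprema of bounded sets of naturals and hence upper bounds.\<close>

lemma divides_monom_lcm:
  fixes S :: "('v::finite \<Rightarrow>\<^sub>0 nat) set"
  assumes "\<forall>f\<in>S. monom_degree f = d" "f \<in> S"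
  shows "f \<preceq> monom_lcm S"
proof
  fix i
  have "Poly_Mapping.lookup e i \<le> d" if "e \<in> S" for e
    using assms(1) that member_le_sum[of i UNIV "Poly_Mapping.lookup e"]
    by (auto simp: monom_degree_def)
  then have "bdd_above ((\<lambda>e. Poly_Mapping.lookup e i) ` S)"
    by (auto intro: bdd_aboveI[of _ d])
  then show "Poly_Mapping.lookup f i \<le> Poly_Mapping.lookup (monom_lcm S) i"
    unfolding lookup_monom_lcm using assms(2) by (intro cSup_upper) auto
qed

section \<open>Minimal generators of monomial ideals\<close>

lemma ring_of_type_algebra_sel [simp]:
  "carrier ring_of_type_algebra = UNIV"
  "x \<oplus>\<^bsub>ring_of_type_algebra\<^esub> y = x + y"
  "x \<otimes>\<^bsub>ring_of_type_algebra\<^esub> y = x * y"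
  "\<one>\<^bsub>ring_of_type_algebra\<^esub> = 1"
  "\<zero>\<^bsub>ring_of_type_algebra\<^esub> = 0"
  by (simp_all add: ring_of_type_algebra_def)

lemma a_inv_ring_of_type_algebra [simp]:
  "\<ominus>\<^bsub>ring_of_type_algebra\<^esub> x = - (x :: 'a::comm_ring_1)"
proof -
  interpret ring "ring_of_type_algebra :: 'a ring" by (rule ring_from_type_algebra)
  show ?thesis by (rule minus_equality) simp_all
qed

lemma lookup_single_times:
  fixes q :: "('v, 'k::comm_ring_1) mpoly"
  shows "Poly_Mapping.lookup (Poly_Mapping.single f c * q) e =
    (if f \<preceq> e then c * Poly_Mapping.lookup q (e - f) else 0)"
proof -
  have "Poly_Mapping.lookup (Poly_Mapping.single f c * q) e =
      c * (\<Sum>r. Poly_Mapping.lookup q r when e = f + r)"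
    by (simp add: lookup_mult lookup_single when_mult)
  also have "\<dots> = (if f \<preceq> e then c * Poly_Mapping.lookup q (e - f) else 0)"
  proof (cases "f \<preceq> e")
    case True
    then have "e = f + r \<longleftrightarrow> r = e - f" for r
      using divides_add_diff by (metis add_diff_cancel_left')
    with True show ?thesis by simp
  next
    case False
    then have "e \<noteq> f + r" for r
      by (auto simp: lookup_add)
    with False show ?thesis by auto
  qed
  finally show ?thesis .
qed

lemma monomial_ideal_of_ideal:
  "ideal (monomial_ideal_of S :: ('v, 'k::field) mpoly set) ring_of_type_algebra"
proof -
  interpret ring "ring_of_type_algebra :: ('v, 'k) mpoly ring" by (rule ring_from_type_algebra)
  show ?thesis unfolding monomial_ideal_of_def by (rule genideal_ideal) simp
qed

lemma monomial_ideal_of_minimal: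
  assumes "ideal J (ring_of_type_algebra :: ('v, 'k::field) mpoly ring)" "mpoly_monom ` S \<subseteq> J"
  shows "monomial_ideal_of S \<subseteq> J"
proof -
  interpret ring "ring_of_type_algebra :: ('v, 'k) mpoly ring" by (rule ring_from_type_algebra)
  show ?thesis unfolding monomial_ideal_of_def by (rule genideal_minimal[OF assms])
qed

lemma monom_in_monomial_ideal_of:
  "s \<in> S \<Longrightarrow> mpoly_monom s \<in> (monomial_ideal_of S :: ('v, 'k::field) mpoly set)"
proof -
  interpret ring "ring_of_type_algebra :: ('v, 'k) mpoly ring" by (rule ring_from_type_algebra)
  show "s \<in> S \<Longrightarrow> ?thesis"
    unfolding monomial_ideal_of_def using genideal_self[of "mpoly_monom ` S"] by auto
qed

text \<open>The polynomials supported on multiples of \<open>S\<close> are in fact exactly the members of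
  \<open>monomial_ideal_of S\<close>; as an ideal containing the generators they bound it from above.\<close>

lemma supported_on_multiples_ideal:
  "ideal {p :: ('v, 'k::field) mpoly. Poly_Mapping.keys p \<subseteq> multiples S} ring_of_type_algebra"
    (is "ideal ?U ?R")
proof -
  interpret ring ?R by (rule ring_from_type_algebra)
  have mult: "x * a \<in> ?U" if "a \<in> ?U" for a x
  proof -
    have "e + f \<in> multiples S" if "f \<in> multiples S" for e f
      using that by (fastforce simp: multiples_def lookup_add intro: trans_le_add2)
    then show ?thesis
      using that keys_mult[of x a] by blast
  qed
  show ?thesis
  proof (rule idealI)
    show "subgroup ?U (add_monoid ?R)"
    proof (rule add.subgroupI)
      show "?U \<noteq> {}" by (auto intro: exI[of _ 0])
      show "\<ominus>\<^bsub>?R\<^esub> a \<in> ?U" if "a \<in> ?U" for a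
        using that by simp
      show "a \<oplus>\<^bsub>?R\<^esub> b \<in> ?U" if "a \<in> ?U" "b \<in> ?U" for a b
        using that Poly_Mapping.keys_add[of a b] by auto
    qed auto
  qed (use ring_axioms mult in \<open>auto simp: mult.commute\<close>)
qed

lemma monom_in_monomial_ideal_of_iff:
  "mpoly_monom e \<in> (monomial_ideal_of S :: ('v, 'k::field) mpoly set) \<longleftrightarrow> e \<in> multiples S"
proof
  assume "mpoly_monom e \<in> (monomial_ideal_of S :: ('v, 'k) mpoly set)"
  moreover have "monomial_ideal_of S \<subseteq> {p :: ('v, 'k) mpoly. Poly_Mapping.keys p \<subseteq> multiples S}"
    by (rule monomial_ideal_of_minimal[OF supported_on_multiples_ideal])
      (auto simp: mpoly_monom_def multiples_def)
  ultimately show "e \<in> multiples S"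
    by (auto simp: mpoly_monom_def)
next
  assume "e \<in> multiples S"
  then obtain s where s: "s \<in> S" "s \<preceq> e"
    by (auto simp: multiples_def)
  interpret ideal "monomial_ideal_of S :: ('v, 'k) mpoly set" ring_of_type_algebra
    by (rule monomial_ideal_of_ideal)
  have "mpoly_monom (e - s) * mpoly_monom s \<in> (monomial_ideal_of S :: ('v, 'k) mpoly set)"
    using I_l_closed[OF monom_in_monomial_ideal_of[OF s(1)]] by simp
  then show "mpoly_monom e \<in> (monomial_ideal_of S :: ('v, 'k) mpoly set)"
    using divides_add_diff[OF s(2)] by (simp add: mpoly_monom_def mult_single add.commute)
qed

lemma monomial_ideal_of_eq_iff:
  "(monomial_ideal_of S :: ('v, 'k::field) mpoly set) = monomial_ideal_of T
    \<longleftrightarrow> multiples S = multiples T"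
proof
  assume "(monomial_ideal_of S :: ('v, 'k) mpoly set) = monomial_ideal_of T"
  then show "multiples S = multiples T"
    using monom_in_monomial_ideal_of_iff by blast
next
  have "(monomial_ideal_of S :: ('v, 'k) mpoly set) \<subseteq> monomial_ideal_of T"
    if "multiples S = multiples T" for S T :: "('v \<Rightarrow>\<^sub>0 nat) set"
  proof (rule monomial_ideal_of_minimal[OF monomial_ideal_of_ideal])
    have "S \<subseteq> multiples T"
      unfolding that[symmetric] by (auto simp: multiples_def)
    then show "mpoly_monom ` S \<subseteq> (monomial_ideal_of T :: ('v, 'k) mpoly set)"
      using monom_in_monomial_ideal_of_iff by blast
  qed
  then show "(monomial_ideal_of S :: ('v, 'k) mpoly set) = monomial_ideal_of T"
    if "multiples S = multiples T"
    using that by blast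
qed

text \<open>By \<open>antichain_subset\<close> an antichain \<open>S\<close> lies in every monomial generating set of its
  ideal, so it is the only one without a smaller generating subset.\<close>

lemma min_gens_monomial_ideal_of:
  assumes "antichain S"
  shows "min_gens (monomial_ideal_of S :: ('v, 'k::field) mpoly set) = S"
  unfolding min_gens_def monomial_ideal_of_eq_iff
  using antichain_subset[OF assms] by (intro the_equality) blast+

lemma antichain_min_gens:
  fixes I :: "('v::finite, 'k::field) mpoly set"
  assumes "monomial_ideal I"
  shows "antichain (min_gens I)"
proof -
  obtain S where "I = monomial_ideal_of S"
    using assms by (auto simp: monomial_ideal_def)
  moreover obtain T where "antichain T" "multiples T = multiples S"
    using ex_antichain_multiples_eq by blast
  ultimately show ?thesis
    by (metis monomial_ideal_of_eq_iff min_gens_monomial_ideal_of)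
qed

section \<open>The reflection of exponents\<close>

definition reflect_mpoly :: "('v \<Rightarrow>\<^sub>0 nat) \<Rightarrow> ('v, 'k::zero) mpoly \<Rightarrow> ('v, 'k) mpoly" where
  "reflect_mpoly m q = Abs_poly_mapping (\<lambda>e. if e \<preceq> m then Poly_Mapping.lookup q (m - e) else 0)"

definition monom_power :: "nat \<Rightarrow> ('v \<Rightarrow>\<^sub>0 nat) \<Rightarrow> ('v \<Rightarrow>\<^sub>0 nat)" where
  "monom_power j m = Poly_Mapping.map (\<lambda>a. j * a) m"

text \<open>Defining the reflection through coefficients makes it total and additive on all of \<open>R[t]\<close>:
  it annihilates the monomials \<open>x\<^sup>e t\<^sup>j\<close> in which \<open>x\<^sup>e\<close> does not divide \<open>m\<^sup>j\<close>.\<close>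

definition reflect :: "('v \<Rightarrow>\<^sub>0 nat) \<Rightarrow> ('v, 'k::zero) mpoly poly \<Rightarrow> ('v, 'k) mpoly poly" where
  "reflect m p = Abs_poly (\<lambda>j. reflect_mpoly (monom_power j m) (poly.coeff p j))"

definition reflectable :: "('v \<Rightarrow>\<^sub>0 nat) \<Rightarrow> ('v, 'k::zero) mpoly poly \<Rightarrow> bool" where
  "reflectable m p \<longleftrightarrow>
    (\<forall>j e. Poly_Mapping.lookup (poly.coeff p j) e \<noteq> 0 \<longrightarrow> e \<preceq> monom_power j m)"

lemma lookup_reflect_mpoly:
  "Poly_Mapping.lookup (reflect_mpoly m q) e =
    (if e \<preceq> m then Poly_Mapping.lookup q (m - e) else 0)"
proof -
  let ?f = "\<lambda>e. if e \<preceq> m then Poly_Mapping.lookup q (m - e) else 0"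
  \<comment> \<open>an exponent \<open>e\<close> dividing \<open>m\<close> is recovered from \<open>m - e\<close>\<close>
  have "{e. ?f e \<noteq> 0} \<subseteq> (\<lambda>e. m - e) ` {e. Poly_Mapping.lookup q e \<noteq> 0}"
  proof
    fix e assume "e \<in> {e. ?f e \<noteq> 0}"
    then have "e \<preceq> m" "Poly_Mapping.lookup q (m - e) \<noteq> 0"
      by (auto split: if_splits)
    then show "e \<in> (\<lambda>e. m - e) ` {e. Poly_Mapping.lookup q e \<noteq> 0}"
      using complement_complement[of e m] by (auto intro!: image_eqI[of _ _ "m - e"])
  qed
  then have "finite {e. ?f e \<noteq> 0}"
    by (rule finite_subset) simp
  then show ?thesis
    unfolding reflect_mpoly_def by simp
qed

lemma lookup_monom_power:
  "Poly_Mapping.lookup (monom_power j m) i = j * Poly_Mapping.lookup m i"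
  by (auto simp: monom_power_def Poly_Mapping.map.rep_eq when_def)

lemma coeff_reflect:
  "poly.coeff (reflect m p) j = reflect_mpoly (monom_power j m) (poly.coeff p j)"
proof -
  let ?f = "\<lambda>j. reflect_mpoly (monom_power j m) (poly.coeff p j)"
  have "?f i = 0" if "i > degree p" for i
    using that by (intro poly_mapping_eqI) (simp add: lookup_reflect_mpoly coeff_eq_0)
  from coeff_Abs_poly[of "degree p" ?f, OF this] show ?thesis
    unfolding reflect_def by simp
qed

lemma lookup_coeff_reflect:
  "Poly_Mapping.lookup (poly.coeff (reflect m p) j) e =
    (if e \<preceq> monom_power j m
     then Poly_Mapping.lookup (poly.coeff p j) (monom_power j m - e) else 0)"
  by (simp add: coeff_reflect lookup_reflect_mpoly)

lemma mpoly_poly_eqI: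
  assumes "\<And>j e. Poly_Mapping.lookup (poly.coeff p j) e = Poly_Mapping.lookup (poly.coeff q j) e"
  shows "p = q"
  using assms by (intro poly_eqI poly_mapping_eqI)

lemma reflect_add: "reflect m (p + q) = reflect m p + reflect m (q :: ('v, 'k::field) mpoly poly)"
  by (rule mpoly_poly_eqI) (simp add: lookup_coeff_reflect lookup_add)

lemma reflect_uminus: "reflect m (- p) = - reflect m (p :: ('v, 'k::field) mpoly poly)"
  by (rule mpoly_poly_eqI) (simp add: lookup_coeff_reflect)

lemma reflect_reflect:
  assumes "reflectable m p"
  shows "reflect m (reflect m p) = p"
proof (rule mpoly_poly_eqI)
  fix j e
  show "Poly_Mapping.lookup (poly.coeff (reflect m (reflect m p)) j) e =
      Poly_Mapping.lookup (poly.coeff p j) e"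
    using assms complement_divides[of "monom_power j m" e]
      complement_complement[of e "monom_power j m"]
    unfolding lookup_coeff_reflect reflectable_def by auto
qed

lemma lookup_coeff_one:
  "Poly_Mapping.lookup (poly.coeff (1 :: ('v, 'k::field) mpoly poly) j) e
    = (if j = 0 \<and> e = 0 then 1 else 0)"
  by (auto simp: coeff_1 lookup_one when_def)

lemma reflectable_one: "reflectable m (1 :: ('v, 'k::field) mpoly poly)"
  unfolding reflectable_def lookup_coeff_one by (auto split: if_splits)

lemma reflectable_add:
  "reflectable m p \<Longrightarrow> reflectable m q \<Longrightarrow> reflectable m (p + q :: ('v, 'k::field) mpoly poly)"
  unfolding reflectable_def by (metis coeff_add lookup_add add.right_neutral)

lemma reflectable_uminus:
  "reflectable m p \<Longrightarrow> reflectable m (- p :: ('v, 'k::field) mpoly poly)"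
  by (simp add: reflectable_def)

lemma reflect_one: "reflect m 1 = (1 :: ('v, 'k::field) mpoly poly)"
proof (rule mpoly_poly_eqI)
  fix j e
  \<comment> \<open>the coefficients at \<open>t\<^sup>0\<close> are reflected in \<open>m\<^sup>0 = 1\<close>\<close>
  have "monom_power 0 m = 0"
    by (intro poly_mapping_eqI) (simp add: lookup_monom_power)
  then show "Poly_Mapping.lookup (poly.coeff (reflect m 1) j) e =
      Poly_Mapping.lookup (poly.coeff (1 :: ('v, 'k) mpoly poly) j) e"
    unfolding lookup_coeff_reflect lookup_coeff_one
    by (auto intro: poly_mapping_eqI)
qed

lemma lookup_coeff_const_times:
  "Poly_Mapping.lookup (poly.coeff (const_Rt c * p) j) e = c * Poly_Mapping.lookup (poly.coeff p j) e"
  by (simp add: const_Rt_def lookup_single_times)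

lemma reflectable_const_times: "reflectable m p \<Longrightarrow> reflectable m (const_Rt c * p)"
  by (simp add: reflectable_def lookup_coeff_const_times)

lemma reflect_const_times: "reflect m (const_Rt c * p) = const_Rt c * reflect m p"
  by (rule mpoly_poly_eqI) (simp add: lookup_coeff_const_times lookup_coeff_reflect)

definition monom_t :: "('v \<Rightarrow>\<^sub>0 nat) \<Rightarrow> ('v, 'k::field) mpoly poly" where
  "monom_t f = Polynomial.monom (mpoly_monom f) 1"

lemma lookup_coeff_monom_t_times:
  "Poly_Mapping.lookup (poly.coeff (monom_t f * p) j) e =
    (if j > 0 \<and> f \<preceq> e then Poly_Mapping.lookup (poly.coeff p (j - 1)) (e - f) else 0)"
  by (auto simp: monom_t_def coeff_monom_mult mpoly_monom_def lookup_single_times)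

lemma reflectable_monom_t_times:
  assumes "reflectable m p" "f \<preceq> m"
  shows "reflectable m (monom_t f * p)"
  unfolding reflectable_def
proof (intro allI impI)
  fix j e i
  assume "Poly_Mapping.lookup (poly.coeff (monom_t f * p) j) e \<noteq> 0"
  then have "j > 0" and e: "e - f \<preceq> monom_power (j - 1) m"
    using assms(1) by (auto simp: lookup_coeff_monom_t_times reflectable_def split: if_splits)
  then obtain l where "j = Suc l"
    by (cases j) auto
  with e[rule_format, of i] assms(2)[rule_format, of i]
  show "Poly_Mapping.lookup e i \<le> Poly_Mapping.lookup (monom_power j m) i"
    by (simp add: lookup_monom_power lookup_minus)
qed

text \<open>The case \<open>m\<^sup>j\<^sup>+\<^sup>1 / (f x\<^sup>e) = (m/f) (m\<^sup>j / x\<^sup>e)\<close> of multiplicativity. Reflectability of \<open>p\<close>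
  cannot be dropped: a term of \<open>p\<close> that the reflection annihilates may survive after
  multiplication by \<open>f t\<close>.\<close>

lemma reflect_monom_t_times:
  assumes "reflectable m p" "f \<preceq> m"
  shows "reflect m (monom_t f * p) = monom_t (m - f) * reflect m p"
proof (rule mpoly_poly_eqI)
  fix j e
  show "Poly_Mapping.lookup (poly.coeff (reflect m (monom_t f * p)) j) e =
      Poly_Mapping.lookup (poly.coeff (monom_t (m - f) * reflect m p) j) e"
  proof (cases j)
    case 0
    then show ?thesis
      by (simp add: lookup_coeff_reflect lookup_coeff_monom_t_times)
  next
    case (Suc l)
    let ?M = "monom_power (Suc l) m" and ?N = "monom_power l m"
    have M: "?M = m + ?N"
      by (intro poly_mapping_eqI) (simp add: lookup_monom_power lookup_add)
    have lhs: "Poly_Mapping.lookup (poly.coeff (reflect m (monom_t f * p)) j) e =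
        (if e \<preceq> ?M \<and> f \<preceq> ?M - e then Poly_Mapping.lookup (poly.coeff p l) (?M - e - f) else 0)"
      by (simp add: Suc lookup_coeff_reflect lookup_coeff_monom_t_times)
    have rhs: "Poly_Mapping.lookup (poly.coeff (monom_t (m - f) * reflect m p) j) e =
        (if m - f \<preceq> e \<and> e - (m - f) \<preceq> ?N
         then Poly_Mapping.lookup (poly.coeff p l) (?N - (e - (m - f))) else 0)"
      by (simp add: Suc lookup_coeff_reflect lookup_coeff_monom_t_times)
    \<comment> \<open>exponentwise facts for \<open>a, b, c, n\<close> the exponents of a variable in \<open>e, m, f, m\<^sup>l\<close>\<close>
    have le: "(a \<le> b + n \<and> c \<le> b + n - a) = (a - (b - c) \<le> n)"
      if "b - c \<le> a" "c \<le> b" for a b c n :: nat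
      using that by arith
    have eq: "b + n - a - c = n - (a - (b - c))" if "b - c \<le> a" "c \<le> b" for a b c n :: nat
      using that by arith
    have gt: "b - c \<le> a" if "a \<le> b + n" "c \<le> b + n - a" "b + n - a - c \<le> n" for a b c n :: nat
      using that by arith
    show ?thesis
    proof (cases "m - f \<preceq> e")
      case True
      have "e \<preceq> ?M \<and> f \<preceq> ?M - e \<longleftrightarrow> e - (m - f) \<preceq> ?N"
        using True assms(2) le unfolding M lookup_add lookup_minus all_conj_distrib[symmetric] by simp
      moreover have "?M - e - f = ?N - (e - (m - f))"
        using True assms(2) eq unfolding M
        by (intro poly_mapping_eqI) (simp only: lookup_add lookup_minus)
      ultimately show ?thesis
        unfolding lhs rhs using True by simp
    next
      case False
      \<comment> \<open>only a term \<open>x\<^sup>g t\<^sup>l\<close> of \<open>p\<close> with \<open>x\<^sup>g\<close> not dividing \<open>m\<^sup>l\<close> could contribute to the left-hand side\<close>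
      have "Poly_Mapping.lookup (poly.coeff p l) (?M - e - f) = 0" if "e \<preceq> ?M" "f \<preceq> ?M - e"
      proof (rule ccontr)
        assume "Poly_Mapping.lookup (poly.coeff p l) (?M - e - f) \<noteq> 0"
        then have "?M - e - f \<preceq> ?N"
          using assms(1) unfolding reflectable_def by blast
        then have "m - f \<preceq> e"
          using that gt unfolding M lookup_add lookup_minus by blast
        with False show False ..
      qed
      then show ?thesis
        unfolding lhs rhs using False by auto
    qed
  qed
qed

lemma reflect_const: "reflect m (const_Rt c) = const_Rt c"
  using reflect_const_times[of m c 1] by (simp add: reflect_one)

lemma reflect_monom_t:
  assumes "f \<preceq> m"
  shows "reflect m (monom_t f :: ('v, 'k::field) mpoly poly) = monom_t (m - f)"
  using reflect_monom_t_times[of m "1 :: ('v, 'k) mpoly poly" f] assms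
  by (simp add: reflectable_one reflect_one)

section \<open>Algebras generated by monomials of degree one in the new variable\<close>

definition monom_t_algebra :: "('v \<Rightarrow>\<^sub>0 nat) set \<Rightarrow> ('v, 'k::field) mpoly poly set" where
  "monom_t_algebra S =
    generate_ring ring_of_type_algebra (range const_Rt \<union> monom_t ` S)"

lemma monom_t_algebra_closed:
  "1 \<in> monom_t_algebra S"
  "const_Rt c \<in> monom_t_algebra S"
  "f \<in> S \<Longrightarrow> monom_t f \<in> monom_t_algebra S"
  "x \<in> monom_t_algebra S \<Longrightarrow> - x \<in> monom_t_algebra S"
  "x \<in> monom_t_algebra S \<Longrightarrow> y \<in> monom_t_algebra S \<Longrightarrow> x + y \<in> monom_t_algebra S"
  "x \<in> monom_t_algebra S \<Longrightarrow> y \<in> monom_t_algebra S \<Longrightarrow> x * y \<in> monom_t_algebra S"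
  unfolding monom_t_algebra_def
  using generate_ring.intros[where R = ring_of_type_algebra and H = "range const_Rt \<union> monom_t ` S"]
  by auto

lemma monom_t_algebra_induct [consumes 1, case_names one const monom_t uminus add mult]:
  assumes "x \<in> monom_t_algebra S"
    and "P 1"
    and "\<And>c. P (const_Rt c)"
    and "\<And>f. f \<in> S \<Longrightarrow> P (monom_t f)"
    and "\<And>x. x \<in> monom_t_algebra S \<Longrightarrow> P x \<Longrightarrow> P (- x)"
    and "\<And>x y. x \<in> monom_t_algebra S \<Longrightarrow> P x \<Longrightarrow> y \<in> monom_t_algebra S \<Longrightarrow> P y \<Longrightarrow> P (x + y)"
    and "\<And>x y. x \<in> monom_t_algebra S \<Longrightarrow> P x \<Longrightarrow> y \<in> monom_t_algebra S \<Longrightarrow> P y \<Longrightarrow> P (x * y)"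
  shows "P x"
  using assms(1) unfolding monom_t_algebra_def
  by (induction rule: generate_ring.induct)
    (use assms(2-) in \<open>auto simp: monom_t_algebra_def\<close>)

text \<open>Quantifying over every reflectable second factor lets the induction on the first factor
  reduce to generators: a product \<open>x y\<close> acts on \<open>z\<close> as \<open>x\<close> does on \<open>y z\<close>. With \<open>z = 1\<close> it also
  yields that the whole algebra is reflectable.\<close>

lemma reflect_times:
  fixes p q :: "('v, 'k::field) mpoly poly"
  assumes "\<forall>f\<in>S. f \<preceq> m" "p \<in> monom_t_algebra S" "reflectable m q"
  shows "reflectable m (p * q) \<and> reflect m (p * q) = reflect m p * reflect m q"
  using assms(2,3)
proof (induction arbitrary: q rule: monom_t_algebra_induct)
  case one
  then show ?case by (simp add: reflect_one)
next
  case (const c)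
  then show ?case
    by (simp add: reflect_const reflect_const_times reflectable_const_times)
next
  case (monom_t f)
  then show ?case
    using assms(1) by (simp add: reflect_monom_t reflectable_monom_t_times reflect_monom_t_times)
next
  case (uminus x)
  then show ?case by (simp add: reflect_uminus reflectable_uminus)
next
  case (add x y)
  then show ?case by (simp add: reflect_add reflectable_add distrib_right)
next
  case (mult x y)
  have "reflectable m y"
    using mult.IH(2)[OF reflectable_one] by simp
  then have "reflect m (x * y) = reflect m x * reflect m y"
    using mult.IH(1) by blast
  then show ?case
    using mult.IH(1)[of "y * q"] mult.IH(2)[of q] mult.prems by (simp add: mult.assoc)
qed

lemma monom_t_algebra_reflectable:
  assumes "\<forall>f\<in>S. f \<preceq> m" "p \<in> monom_t_algebra S"
  shows "reflectable m p"
  using reflect_times[OF assms reflectable_one] by simp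

lemma reflect_generated_algebra:
  fixes p :: "('v, 'k::field) mpoly poly"
  assumes "\<forall>f\<in>S. f \<preceq> m" "p \<in> monom_t_algebra S"
  shows "reflect m p \<in> monom_t_algebra ((\<lambda>f. m - f) ` S)"
  using assms(2)
proof (induction rule: monom_t_algebra_induct)
  case (monom_t f)
  then show ?case
    using assms(1) by (simp add: reflect_monom_t monom_t_algebra_closed)
next
  case (mult x y)
  then show ?case
    using reflect_times[OF assms(1) mult.hyps(1)] monom_t_algebra_reflectable[OF assms(1) mult.hyps(2)]
    by (simp add: monom_t_algebra_closed)
qed (simp_all add: reflect_one reflect_const reflect_uminus reflect_add monom_t_algebra_closed)

lemma K_alg_isomorphic_complement:
  assumes S: "\<forall>f\<in>S. f \<preceq> m"
  shows "K_alg_isomorphic (monom_t_algebra S :: ('v, 'k::field) mpoly poly set)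
    (monom_t_algebra ((\<lambda>f. m - f) ` S))"
proof -
  let ?A = "monom_t_algebra S :: ('v, 'k) mpoly poly set"
  let ?T = "(\<lambda>f. m - f) ` S"
  let ?B = "monom_t_algebra ?T :: ('v, 'k) mpoly poly set"
  have T: "\<forall>f\<in>?T. f \<preceq> m"
    by (simp add: complement_divides)
  have "(\<lambda>f. m - f) ` ?T = S"
    using S by (force simp: image_image complement_complement)
  then have converse: "reflect m q \<in> ?A" if "q \<in> ?B" for q
    using reflect_generated_algebra[OF T that] by simp
  have "bij_betw (reflect m) ?A ?B"
  proof (rule bij_betw_byWitness[where f' = "reflect m"])
    show "\<forall>p\<in>?A. reflect m (reflect m p) = p"
      using reflect_reflect[OF monom_t_algebra_reflectable[OF S]] by auto
    show "\<forall>q\<in>?B. reflect m (reflect m q) = q"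
      using reflect_reflect[OF monom_t_algebra_reflectable[OF T]] by auto
    show "reflect m ` ?A \<subseteq> ?B"
      using reflect_generated_algebra[OF S] by auto
    show "reflect m ` ?B \<subseteq> ?A"
      using converse by auto
  qed
  moreover have "reflect m \<in> ring_hom (ring_of_type_algebra\<lparr>carrier := ?A\<rparr>)
      (ring_of_type_algebra\<lparr>carrier := ?B\<rparr>)"
    by (rule ring_hom_memI)
      (simp_all add: reflect_generated_algebra[OF S] reflect_add reflect_one
        reflect_times[OF S] monom_t_algebra_reflectable[OF S])
  ultimately have "reflect m \<in> ring_iso (ring_of_type_algebra\<lparr>carrier := ?A\<rparr>)
      (ring_of_type_algebra\<lparr>carrier := ?B\<rparr>)"
    by (simp add: ring_iso_def)
  then show ?thesis
    unfolding K_alg_isomorphic_def by (rule bexI[rotated]) (simp add: reflect_const)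
qed

theorem theorem2p5:
  fixes I :: "('v::finite, 'k::field) mpoly set"
  assumes "monomial_ideal I"
    and "ideal_height ring_of_type_algebra I \<ge> 2"
    and "\<exists>d. \<forall>f\<in>min_gens I. monom_degree f = d"
  shows "K_alg_isomorphic (special_fiber I) (special_fiber (lcm_dual I))"
proof -
  let ?m = "monom_lcm (min_gens I)"
  have m: "\<forall>f\<in>min_gens I. f \<preceq> ?m"
    using assms(3) divides_monom_lcm by blast
  have "min_gens (lcm_dual I) = (\<lambda>f. ?m - f) ` min_gens I"
    unfolding lcm_dual_def
    by (rule min_gens_monomial_ideal_of[OF
          antichain_complement[OF antichain_min_gens[OF assms(1)] m]])
  then show ?thesis
    using K_alg_isomorphic_complement[OF m]
    by (simp add: special_fiber_def monom_t_algebra_def monom_t_def)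
qed

end
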